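(* If $\ell(\cdot,b):\mathbb{R}^s\to\mathbb{R}$ and all $r_i:\mathbb{R}^{d_i}\to\mathbb{R}$, $i=1,\dots,n$, are convex, then the function $$L(x,z,y)=\ell(z,b)+\sum_{i=1}^nr_i(x_i)+y^T\Big(\sum_{i=1}^nA_ix_i-z\Big)$$ is convex--concave: for every $y\in\mathbb{R}^s$ it is convex in $(x,z)\in\mathbb{R}^{d+s}$, and for every $(x,z)\in\mathbb{R}^{d+s}$ it is concave in $y\in\mathbb{R}^s$.
   Context: $n,s,d_1,\dots,d_n$ are positive integers, $d=\sum_id_i$, $A_i\in\mathbb{R}^{s\times d_i}$, $b\in\mathbb{R}^s$ is fixed, $\ell:\mathbb{R}^s\times\mathbb{R}^s\to\mathbb{R}$, and $x=(x_1,\dots,x_n)\in\mathbb{R}^d$ with $x_i\in\mathbb{R}^{d_i}$. *)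

theory Defs
  imports "Jordan_Normal_Form.Matrix" "HOL-Analysis.Convex"
begin

(* Both the vector type of HOL-Analysis and that of Jordan_Normal_Form use the infix dot. *)
unbundle no inner_syntax

(* The block dimensions d i vary with the index i, so R^m is rendered as carrier_vec m.  The type
   real vec mixes all dimensions and is not a real_vector, so convex_on is not applicable to it;
   the two definitions below are convex_on and concave_on read over carrier_vec m, without the
   conjunct that the domain is convex, which always holds there. *)

definition convex_vec :: "nat \<Rightarrow> (real vec \<Rightarrow> real) \<Rightarrow> bool" where
  "convex_vec m f \<longleftrightarrow>
    (\<forall>x \<in> carrier_vec m. \<forall>y \<in> carrier_vec m. \<forall>u\<ge>0. \<forall>v\<ge>0. u + v = 1 \<longrightarrow>
      f (u \<cdot>\<^sub>v x + v \<cdot>\<^sub>v y) \<le> u * f x + v * f y)"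

definition concave_vec :: "nat \<Rightarrow> (real vec \<Rightarrow> real) \<Rightarrow> bool" where
  "concave_vec m f \<longleftrightarrow> convex_vec m (\<lambda>x. - f x)"

lemma convex_vec_iff_convex_on:
  fixes \<phi> :: "'a :: real_vector \<Rightarrow> real vec"
  assumes "bij_betw \<phi> UNIV (carrier_vec m)"
    and "\<And>x y. \<phi> (x + y) = \<phi> x + \<phi> y"
    and "\<And>c x. \<phi> (c *\<^sub>R x) = c \<cdot>\<^sub>v \<phi> x"
  shows "convex_vec m f \<longleftrightarrow> convex_on UNIV (\<lambda>x. f (\<phi> x))"
proof -
  have "carrier_vec m = range \<phi>"
    using assms(1) by (simp add: bij_betw_def)
  then show ?thesis
    by (simp add: convex_vec_def convex_on_def assms(2,3))
qed

lemma concave_vec_iff_concave_on: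
  fixes \<phi> :: "'a :: real_vector \<Rightarrow> real vec"
  assumes "bij_betw \<phi> UNIV (carrier_vec m)"
    and "\<And>x y. \<phi> (x + y) = \<phi> x + \<phi> y"
    and "\<And>c x. \<phi> (c *\<^sub>R x) = c \<cdot>\<^sub>v \<phi> x"
  shows "concave_vec m f \<longleftrightarrow> concave_on UNIV (\<lambda>x. f (\<phi> x))"
  unfolding concave_vec_def concave_on_def
  by (rule convex_vec_iff_convex_on[OF assms])

(* x is the concatenation of blocks of lengths d 0, d 1, ...; blocks are numbered from 0. *)
definition vec_block :: "(nat \<Rightarrow> nat) \<Rightarrow> real vec \<Rightarrow> nat \<Rightarrow> real vec" where
  "vec_block d x i = vec (d i) (\<lambda>j. x $ ((\<Sum>k<i. d k) + j))"

definition lagrangian ::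
  "nat \<Rightarrow> nat \<Rightarrow> (nat \<Rightarrow> nat) \<Rightarrow> (nat \<Rightarrow> real mat) \<Rightarrow> real vec \<Rightarrow>
   (real vec \<Rightarrow> real vec \<Rightarrow> real) \<Rightarrow> (nat \<Rightarrow> real vec \<Rightarrow> real) \<Rightarrow>
   real vec \<Rightarrow> real vec \<Rightarrow> real vec \<Rightarrow> real" where
  "lagrangian n s d A b l r x z y =
     l z b + (\<Sum>i<n. r i (vec_block d x i))
     + y \<bullet> (finsum_vec TYPE(real) s (\<lambda>i. A i *\<^sub>v vec_block d x i) {..<n} - z)"

end

theory Submission
  imports Defs
begin

(* The coupling term is linear in (x, z) for fixed y and linear in y for fixed (x, z), and l and
   the r i enter composed with linear projections; convexity survives both operations. *)

text \<open>Fix y and read (x, z) as one vector w. Every term of \<open>lagrangian\<close> is then a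
  convex function after a linear map: \<open>l\<close> after the projection to z, \<open>r i\<close>
  after the projection to a block, and the functional \<open>y \<bullet> _\<close> after the
  residual map. Convexity survives linear substitution (\<open>convex_vec_compose_linear\<close>)
  and sums (\<open>convex_vec_add\<close>, \<open>convex_vec_sum\<close>). With x and z fixed, the
  function is affine in y, hence concave. \<open>linear_vec\<close> merges additivity and
  homogeneity into the shape of combination that \<open>convex_vec\<close> tests, so linearity can
  be used there as a rewrite rule.\<close>

definition linear_vec :: "nat \<Rightarrow> nat \<Rightarrow> (real vec \<Rightarrow> real vec) \<Rightarrow> bool" where
  "linear_vec m k g \<longleftrightarrow> g \<in> carrier_vec m \<rightarrow> carrier_vec k \<and>
    (\<forall>x \<in> carrier_vec m. \<forall>y \<in> carrier_vec m. \<forall>u v.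
      g (u \<cdot>\<^sub>v x + v \<cdot>\<^sub>v y) = u \<cdot>\<^sub>v g x + v \<cdot>\<^sub>v g y)"

lemma linear_vecI:
  assumes "\<And>x. x \<in> carrier_vec m \<Longrightarrow> g x \<in> carrier_vec k"
    and "\<And>x y u v. x \<in> carrier_vec m \<Longrightarrow> y \<in> carrier_vec m \<Longrightarrow>
      g (u \<cdot>\<^sub>v x + v \<cdot>\<^sub>v y) = u \<cdot>\<^sub>v g x + v \<cdot>\<^sub>v g y"
  shows "linear_vec m k g"
  using assms by (auto simp: linear_vec_def)

lemma linear_vec_closed:
  "linear_vec m k g \<Longrightarrow> x \<in> carrier_vec m \<Longrightarrow> g x \<in> carrier_vec k"
  by (auto simp: linear_vec_def)

lemma linear_vec_lincomb:
  "linear_vec m k g \<Longrightarrow> x \<in> carrier_vec m \<Longrightarrow> y \<in> carrier_vec m \<Longrightarrow>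
    g (u \<cdot>\<^sub>v x + v \<cdot>\<^sub>v y) = u \<cdot>\<^sub>v g x + v \<cdot>\<^sub>v g y"
  by (auto simp: linear_vec_def)

lemma linear_vec_compose:
  assumes "linear_vec m k g" and "linear_vec k p h"
  shows "linear_vec m p (\<lambda>x. h (g x))"
  by (rule linear_vecI) (simp_all add: linear_vec_closed[OF assms(1)] linear_vec_closed[OF assms(2)]
      linear_vec_lincomb[OF assms(1)] linear_vec_lincomb[OF assms(2)])

lemma linear_vec_first: "linear_vec (m + k) m (\<lambda>w. vec_first w m)"
  by (rule linear_vecI) (auto simp: vec_first_def)

text \<open>\<open>vec_last\<close> computes its offset from \<open>dim_vec\<close>; on vectors of
  length \<open>m + k\<close> that offset is always m, so the same coordinates are read
  throughout.\<close>

lemma linear_vec_last: "linear_vec (m + k) k (\<lambda>w. vec_last w k)"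
  by (rule linear_vecI) (auto simp: vec_last_def)

text \<open>A block reads entries at fixed positions, which commutes with linear combinations as
  long as the positions lie inside the vector. The proof is this bound: block i ends no later than
  the total length.\<close>

lemma linear_vec_block:
  assumes "i < n"
  shows "linear_vec (\<Sum>k<n. d k) (d i) (\<lambda>x. vec_block d x i)"
proof -
  have "(\<Sum>k<i. d k) + d i = (\<Sum>k<Suc i. d k)"
    by simp
  also have "\<dots> \<le> (\<Sum>k<n. d k)"
    using assms by (intro sum_mono2) auto
  finally have "(\<Sum>k<i. d k) + d i \<le> (\<Sum>k<n. d k)" .
  then show ?thesis
    by (intro linear_vecI) (auto simp: vec_block_def)
qed

lemma linear_vec_mult_mat:
  assumes "A \<in> carrier_mat k m"
  shows "linear_vec m k (\<lambda>x. A *\<^sub>v x)"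
proof (rule linear_vecI)
  fix x y :: "real vec" and u v :: real
  assume "x \<in> carrier_vec m" "y \<in> carrier_vec m"
  then show "A *\<^sub>v (u \<cdot>\<^sub>v x + v \<cdot>\<^sub>v y) = u \<cdot>\<^sub>v (A *\<^sub>v x) + v \<cdot>\<^sub>v (A *\<^sub>v y)"
    using assms by (simp add: mult_add_distrib_mat_vec[of _ k m] mult_mat_vec[of _ k m])
qed (use assms in simp)

text \<open>Compared entry by entry, this is distributivity for sums of reals. Reading an entry by
  \<open>index_finsum_vec\<close> requires all summands to have length k, hence the fact
  \<open>closed\<close>.\<close>

lemma linear_vec_finsum:
  assumes "finite I" and lin: "\<And>i. i \<in> I \<Longrightarrow> linear_vec m k (g i)"
  shows "linear_vec m k (\<lambda>x. finsum_vec TYPE(real) k (\<lambda>i. g i x) I)"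
proof (rule linear_vecI)
  have closed: "(\<lambda>i. g i x) \<in> I \<rightarrow> carrier_vec k" if "x \<in> carrier_vec m" for x
    using linear_vec_closed[OF lin that] by blast
  show fc: "finsum_vec TYPE(real) k (\<lambda>i. g i x) I \<in> carrier_vec k" if "x \<in> carrier_vec m" for x
    using closed[OF that] by (rule finsum_vec_closed)
  fix x y :: "real vec" and u v :: real
  assume xy: "x \<in> carrier_vec m" "y \<in> carrier_vec m"
  then have uv: "u \<cdot>\<^sub>v x + v \<cdot>\<^sub>v y \<in> carrier_vec m"
    by simp
  show "finsum_vec TYPE(real) k (\<lambda>i. g i (u \<cdot>\<^sub>v x + v \<cdot>\<^sub>v y)) I =
    u \<cdot>\<^sub>v finsum_vec TYPE(real) k (\<lambda>i. g i x) I + v \<cdot>\<^sub>v finsum_vec TYPE(real) k (\<lambda>i. g i y) I"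
    (is "?L = ?R")
  proof (rule eq_vecI)
    show "dim_vec ?L = dim_vec ?R"
      using fc[OF xy(2)] fc[OF uv] by simp
    fix j
    assume "j < dim_vec ?R"
    then have j: "j < k"
      using fc[OF xy(2)] by simp
    have "?L $ j = (\<Sum>i\<in>I. g i (u \<cdot>\<^sub>v x + v \<cdot>\<^sub>v y) $ j)"
      by (rule index_finsum_vec[OF assms(1) j closed[OF uv]])
    also have "\<dots> = (\<Sum>i\<in>I. u * g i x $ j + v * g i y $ j)"
    proof (rule sum.cong[OF refl])
      fix i
      assume i: "i \<in> I"
      show "g i (u \<cdot>\<^sub>v x + v \<cdot>\<^sub>v y) $ j = u * g i x $ j + v * g i y $ j"
        using linear_vec_closed[OF lin[OF i] xy(1)] linear_vec_closed[OF lin[OF i] xy(2)] j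
        by (simp add: linear_vec_lincomb[OF lin[OF i] xy])
    qed
    also have "\<dots> = ?R $ j"
      using fc[OF xy(1)] fc[OF xy(2)] j
      by (simp add: index_finsum_vec[OF assms(1) j closed[OF xy(1)]]
          index_finsum_vec[OF assms(1) j closed[OF xy(2)]] sum.distrib sum_distrib_left)
    finally show "?L $ j = ?R $ j" .
  qed
qed

lemma linear_vec_minus:
  assumes "linear_vec m k g" and "linear_vec m k h"
  shows "linear_vec m k (\<lambda>x. g x - h x)"
proof (rule linear_vecI)
  fix x y :: "real vec" and u v :: real
  assume xy: "x \<in> carrier_vec m" "y \<in> carrier_vec m"
  note c = linear_vec_closed[OF assms(1) xy(1)] linear_vec_closed[OF assms(1) xy(2)]
    linear_vec_closed[OF assms(2) xy(1)] linear_vec_closed[OF assms(2) xy(2)]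
  show "g (u \<cdot>\<^sub>v x + v \<cdot>\<^sub>v y) - h (u \<cdot>\<^sub>v x + v \<cdot>\<^sub>v y) =
    u \<cdot>\<^sub>v (g x - h x) + v \<cdot>\<^sub>v (g y - h y)"
    unfolding linear_vec_lincomb[OF assms(1) xy] linear_vec_lincomb[OF assms(2) xy]
    using c by (intro eq_vecI) (auto simp: algebra_simps)
qed (simp add: linear_vec_closed[OF assms(1)] linear_vec_closed[OF assms(2)])

text \<open>g sends a convex combination to the same combination of the images, so the inequality
  for f at g x and g y is the one wanted.\<close>

lemma convex_vec_compose_linear:
  assumes "convex_vec k f" and "linear_vec m k g"
  shows "convex_vec m (\<lambda>x. f (g x))"
  using assms(1)
  by (simp add: convex_vec_def linear_vec_closed[OF assms(2)] linear_vec_lincomb[OF assms(2)])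

lemma convex_vec_add:
  assumes "convex_vec m f" and "convex_vec m g"
  shows "convex_vec m (\<lambda>x. f x + g x)"
  unfolding convex_vec_def
proof (intro ballI allI impI)
  fix x y :: "real vec" and u v :: real
  assume "x \<in> carrier_vec m" "y \<in> carrier_vec m" "0 \<le> u" "0 \<le> v" "u + v = 1"
  then have "f (u \<cdot>\<^sub>v x + v \<cdot>\<^sub>v y) \<le> u * f x + v * f y" "g (u \<cdot>\<^sub>v x + v \<cdot>\<^sub>v y) \<le> u * g x + v * g y"
    using assms by (auto simp: convex_vec_def)
  then show "f (u \<cdot>\<^sub>v x + v \<cdot>\<^sub>v y) + g (u \<cdot>\<^sub>v x + v \<cdot>\<^sub>v y) \<le> u * (f x + g x) + v * (f y + g y)"
    by (simp add: algebra_simps)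
qed

lemma convex_vec_const: "convex_vec m (\<lambda>_. c)"
  \<comment> \<open>Factoring gives (u + v) * c, and u + v = 1.\<close>
  by (simp add: convex_vec_def flip: distrib_right)

lemma convex_vec_sum:
  assumes "\<And>i. i \<in> I \<Longrightarrow> convex_vec m (f i)"
  shows "convex_vec m (\<lambda>x. \<Sum>i\<in>I. f i x)"
  using assms
  \<comment> \<open>Over an infinite I the sum is 0, so this case is a constant, like the empty
    one.\<close>
  by (induction I rule: infinite_finite_induct) (auto intro: convex_vec_const convex_vec_add)

text \<open>A linear functional satisfies the convexity inequality with equality.\<close>

lemma convex_vec_scalar_prod:
  assumes "a \<in> carrier_vec m"
  shows "convex_vec m (\<lambda>x. a \<bullet> x)"
  using assms by (auto simp: convex_vec_def scalar_prod_add_distrib[of _ m])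

lemma convex_vec_lagrangian:
  assumes A: "\<And>i. i < n \<Longrightarrow> A i \<in> carrier_mat s (d i)"
    and l: "convex_vec s (\<lambda>z. l z b)"
    and r: "\<And>i. i < n \<Longrightarrow> convex_vec (d i) (r i)"
    and y: "y \<in> carrier_vec s"
  shows "convex_vec ((\<Sum>i<n. d i) + s)
    (\<lambda>w. lagrangian n s d A b l r (vec_first w (\<Sum>i<n. d i)) (vec_last w s) y)"
proof -
  let ?m = "\<Sum>i<n. d i"
  have block: "linear_vec (?m + s) (d i) (\<lambda>w. vec_block d (vec_first w ?m) i)" if "i < n" for i
    using linear_vec_first linear_vec_block[OF that] by (rule linear_vec_compose)
  \<comment> \<open>The constraint residual is linear in w, so the coupling term is the functional
    given by y after a linear map.\<close>
  have residual: "linear_vec (?m + s) s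
      (\<lambda>w. finsum_vec TYPE(real) s (\<lambda>i. A i *\<^sub>v vec_block d (vec_first w ?m) i) {..<n} - vec_last w s)"
    by (intro linear_vec_minus linear_vec_last linear_vec_finsum)
      (auto intro: linear_vec_compose[OF block linear_vec_mult_mat[OF A]])
  have "convex_vec (?m + s) (\<lambda>w. l (vec_last w s) b)"
    by (rule convex_vec_compose_linear[OF l linear_vec_last])
  moreover have "convex_vec (?m + s) (\<lambda>w. \<Sum>i<n. r i (vec_block d (vec_first w ?m) i))"
    by (rule convex_vec_sum) (auto intro: convex_vec_compose_linear[OF r block])
  ultimately show ?thesis
    unfolding lagrangian_def
    by (intro convex_vec_add convex_vec_compose_linear[OF convex_vec_scalar_prod[OF y] residual])
qed

text \<open>In y there is only a constant plus the scalar product with the fixed residual q.\<close>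

lemma concave_vec_lagrangian:
  assumes A: "\<And>i. i < n \<Longrightarrow> A i \<in> carrier_mat s (d i)"
    and z: "z \<in> carrier_vec s"
  shows "concave_vec s (\<lambda>y. lagrangian n s d A b l r x z y)"
proof -
  define q where "q = finsum_vec TYPE(real) s (\<lambda>i. A i *\<^sub>v vec_block d x i) {..<n} - z"
  \<comment> \<open>A block has length \<open>d i\<close> by construction, which matches the columns
    of \<open>A i\<close>.\<close>
  have "A i *\<^sub>v vec_block d x i \<in> carrier_vec s" if "i < n" for i
    using A[OF that] by (simp add: vec_block_def)
  then have q: "q \<in> carrier_vec s"
    unfolding q_def using z by (intro minus_carrier_vec finsum_vec_closed) auto
  have "convex_vec s (\<lambda>y. - (y \<bullet> q))"
    unfolding convex_vec_def
    using q by (auto simp: add_scalar_prod_distrib[of _ s])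
  \<comment> \<open>The terms free of y are collected into one constant; the result is the negated
    Lagrangian, whose convexity \<open>concave_vec\<close> demands.\<close>
  then have "convex_vec s (\<lambda>y. - (l z b + (\<Sum>i<n. r i (vec_block d x i))) + - (y \<bullet> q))"
    by (intro convex_vec_add convex_vec_const)
  then show ?thesis
    by (simp add: concave_vec_def lagrangian_def q_def algebra_simps)
qed

theorem lemma2:
  fixes n s :: nat
    and d :: "nat \<Rightarrow> nat"
    and A :: "nat \<Rightarrow> real mat"
    and b :: "real vec"
    and l :: "real vec \<Rightarrow> real vec \<Rightarrow> real"
    and r :: "nat \<Rightarrow> real vec \<Rightarrow> real"
  assumes "0 < n" and "0 < s"
    and "\<And>i. i < n \<Longrightarrow> 0 < d i"
    and "\<And>i. i < n \<Longrightarrow> A i \<in> carrier_mat s (d i)"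
    and "b \<in> carrier_vec s"
    and "convex_vec s (\<lambda>z. l z b)"
    and "\<And>i. i < n \<Longrightarrow> convex_vec (d i) (r i)"
  shows "(\<forall>y \<in> carrier_vec s.
            convex_vec ((\<Sum>i<n. d i) + s)
              (\<lambda>w. lagrangian n s d A b l r (vec_first w (\<Sum>i<n. d i)) (vec_last w s) y))
       \<and> (\<forall>x \<in> carrier_vec (\<Sum>i<n. d i). \<forall>z \<in> carrier_vec s.
            concave_vec s (\<lambda>y. lagrangian n s d A b l r x z y))"
  by (intro conjI ballI convex_vec_lagrangian concave_vec_lagrangian assms)

end
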